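(* The number \[ \theta:=\sum_{n=1}^{\infty}\frac{1}{2^{n!}}=\frac12+\frac14+\frac1{64}+\cdots \] is a Liouville number (and thus irrational), and for each $\sigma\in\{\leq,<\}$ and every $n\geq 1$ there is a unique maximizing $n$-term denominator tuple for $R_n^{\sigma}(\theta)$, namely the $n$-term greedy denominator tuple of $\theta$.
   Context: $\mathbb{N}=\{1,2,\ldots\}$. For $n\geq 1$ let $\mathcal{E}_n^{\leq}=\{(a_1,\ldots,a_n)\in\mathbb{N}^n: 2\leq a_1\leq\cdots\leq a_n\}$ and $\mathcal{E}_n^{<}=\{(a_1,\ldots,a_n)\in\mathbb{N}^n: 2\leq a_1<\cdots<a_n\}$. For a real $\mu>0$ and $\sigma\in\{\leq,<\}$ define \[ R_n^{\sigma}(\mu)=\max\Bigl\{\sum_{i=1}^n\frac1{a_i}:\ (a_1,\ldots,a_n)\in\mathcal{E}_n^{\sigma},\ \sum_{i=1}^n\frac1{a_i}<\mu\Bigr\} \] (the maximum is known to exist). A tuple in $\mathcal{E}_n^{\sigma}$ attaining this maximum is called a maximizing $n$-term denominator tuple for $R_n^\sigma(\mu)$. Greedy algorithm: the greedy denominators $g_1,g_2,\ldots$ of $\mu>0$ under the convention $\sigma$ are defined recursively: $g_1$ is the smallest integer $x\geq 2$ with $1/x<\mu$, and $g_{i+1}$ is the smallest integer $x\geq 2$ with $x\geq g_i$ (if $\sigma$ is $\leq$), respectively $x>g_i$ (if $\sigma$ is $<$), for which $1/x<\mu-\sum_{j=1}^{i}1/g_j$. The $n$-term greedy denominator tuple is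 $(g_1,\ldots,g_n)$. A Liouville number is a real number $\theta$ such that for every positive integer $m$ there are integers $P$ and $Q\geq 2$ with $0<|\theta-P/Q|<Q^{-m}$. *)

theory Defs
  imports Complex_Main
begin

text \<open>
  An $n$-tuple of denominators is a list of length $n$. The convention \<open>\<sigma>\<close> is passed as
  the relation itself, either \<open>(\<le>)\<close> or \<open>(<)\<close> on the naturals.
\<close>

definition denominator_tuples :: "(nat \<Rightarrow> nat \<Rightarrow> bool) \<Rightarrow> nat \<Rightarrow> nat list set" where
  "denominator_tuples \<sigma> n = {as. length as = n \<and> (\<forall>a\<in>set as. 2 \<le> a) \<and> sorted_wrt \<sigma> as}"

definition reciprocal_sum :: "nat list \<Rightarrow> real" where
  "reciprocal_sum as = (\<Sum>a\<leftarrow>as. 1 / real a)"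

definition under_tuples :: "(nat \<Rightarrow> nat \<Rightarrow> bool) \<Rightarrow> nat \<Rightarrow> real \<Rightarrow> nat list set" where
  "under_tuples \<sigma> n \<mu> = {as \<in> denominator_tuples \<sigma> n. reciprocal_sum as < \<mu>}"

text \<open>
  The sums range over an infinite set, so its maximum is rendered by \<^const>\<open>Greatest\<close>;
  \<^const>\<open>Max\<close> is meaningful for finite sets only.
\<close>

definition R :: "(nat \<Rightarrow> nat \<Rightarrow> bool) \<Rightarrow> nat \<Rightarrow> real \<Rightarrow> real" where
  "R \<sigma> n \<mu> = (GREATEST s. s \<in> reciprocal_sum ` under_tuples \<sigma> n \<mu>)"

definition maximizing_tuple :: "(nat \<Rightarrow> nat \<Rightarrow> bool) \<Rightarrow> nat \<Rightarrow> real \<Rightarrow> nat list \<Rightarrow> bool" where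
  "maximizing_tuple \<sigma> n \<mu> as \<longleftrightarrow> as \<in> under_tuples \<sigma> n \<mu> \<and> reciprocal_sum as = R \<sigma> n \<mu>"

fun greedy_tuple :: "(nat \<Rightarrow> nat \<Rightarrow> bool) \<Rightarrow> real \<Rightarrow> nat \<Rightarrow> nat list" where
  "greedy_tuple \<sigma> \<mu> 0 = []"
| "greedy_tuple \<sigma> \<mu> (Suc n) =
    (let gs = greedy_tuple \<sigma> \<mu> n in
     gs @ [LEAST x. 2 \<le> x \<and> (gs \<noteq> [] \<longrightarrow> \<sigma> (last gs) x) \<and> 1 / real x < \<mu> - reciprocal_sum gs])"

definition liouville_number :: "real \<Rightarrow> bool" where
  "liouville_number x \<longleftrightarrow>
    (\<forall>m::nat. m \<ge> 1 \<longrightarrow> (\<exists>P Q :: int. Q \<ge> 2 \<and>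
       0 < \<bar>x - of_int P / of_int Q\<bar> \<and> \<bar>x - of_int P / of_int Q\<bar> < 1 / of_int Q ^ m))"

definition theta :: real where
  "theta = (\<Sum>n. 1 / 2 ^ fact (Suc n))"

lemma summable_theta: "summable (\<lambda>n. 1 / 2 ^ fact (Suc n) :: real)"
proof (rule summable_comparison_test')
  show "summable (\<lambda>n. (1 / 2) ^ n :: real)"
    by (rule summable_geometric) simp
  fix n :: nat
  have "n \<le> fact (Suc n)"
    using fact_ge_self[of "Suc n"] by linarith
  then have "(2::real) ^ n \<le> 2 ^ fact (Suc n)"
    by (intro power_increasing) auto
  then show "norm (1 / 2 ^ fact (Suc n) :: real) \<le> (1 / 2) ^ n"
    by (simp add: power_one_over frac_le del: fact_Suc)
qed

end

theory Submission
  imports Defs "HOL-Computational_Algebra.Primes"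
begin

text \<open>
  Let \<open>d\<^sub>i = 2^(i+1)!\<close>. The greedy remainders are the tails of the series, so the greedy
  denominators are the \<open>d\<^sub>i\<close>. Optimality is shown by induction on the length. Suppose a tuple
  \<open>a\<^sub>0 \<le> \<dots> \<le> a\<^sub>n\<close> with sum below \<open>\<theta>\<close> does at least as well as the greedy one. If its first \<open>n\<close>
  terms do as well as the greedy ones, they agree with them, and \<open>a\<^sub>n = d\<^sub>n\<close>. Otherwise
  \<open>1/a\<^sub>n > 1/d\<^sub>n\<close>, so that all entries are smaller than \<open>A = d\<^sub>n\<close>. The greedy sum is an odd multiple
  of \<open>1/A\<close>, and no sum of reciprocals of integers below the power of two \<open>A\<close> has this 2-adic
  valuation, which rules out equality. If the sum is larger, it exceeds the greedy one by at
  least \<open>1/(A \<Prod>a\<^sub>i)\<close>, and \<open>A \<Prod>a\<^sub>i \<le> (A-1) A^(n+1)\<close> makes this more than the tail of the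
  series, which is only slightly larger than \<open>1/A^(n+2)\<close>.
\<close>

section \<open>Irrationality of Liouville numbers\<close>

lemma liouville_number_irrational:
  assumes "liouville_number x"
  shows "x \<notin> \<rat>"
proof
  assume "x \<in> \<rat>"
  then obtain p q :: int where q: "q > 0" and x: "x = of_int p / of_int q"
    by (metis Rats_cases')
  \<comment> \<open>The exponent is q + 1 because a nonzero difference of p/q and P/Q is at least
    1/(qQ); this forces Q^q < q, which fails since q < 2^q <= Q^q.\<close>
  obtain P Q :: int where Q: "Q \<ge> 2" and pos: "0 < \<bar>x - of_int P / of_int Q\<bar>"
    and less: "\<bar>x - of_int P / of_int Q\<bar> < 1 / of_int Q ^ Suc (nat q)"
    using assms unfolding liouville_number_def by (metis le_add1 plus_1_eq_Suc)
  have eq: "x - of_int P / of_int Q = of_int (p * Q - P * q) / (of_int q * of_int Q)"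
    using q Q by (simp add: x field_simps)
  with pos have "p * Q - P * q \<noteq> 0"
    by (metis abs_zero div_0 less_irrefl of_int_0)
  then have "1 \<le> \<bar>of_int (p * Q - P * q) :: real\<bar>" by linarith
  then have "1 / (of_int q * of_int Q) \<le> \<bar>x - of_int P / of_int Q\<bar>"
    unfolding eq abs_divide using q Q by (simp add: divide_right_mono)
  also note less
  finally have "(of_int Q ^ Suc (nat q) :: real) < of_int q * of_int Q"
    using q Q by (simp add: field_simps)
  then have "(of_int Q ^ nat q :: real) < of_int q"
    using Q by simp
  then have "Q ^ nat q < q"
    by (metis of_int_less_iff of_int_power)
  moreover have "q < 2 ^ nat q"
    using q by (metis less_exp nat_0_le less_imp_le of_nat_less_iff of_nat_numeral of_nat_power)
  moreover have "(2::int) ^ nat q \<le> Q ^ nat q"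
    using Q by (intro power_mono) auto
  ultimately show False by linarith
qed

section \<open>Denominators of reciprocal sums\<close>

lemma reciprocal_sum_Nil [simp]: "reciprocal_sum [] = 0"
  by (simp add: reciprocal_sum_def)

lemma reciprocal_sum_Cons [simp]: "reciprocal_sum (a # as) = 1 / real a + reciprocal_sum as"
  by (simp add: reciprocal_sum_def)

lemma reciprocal_sum_append [simp]:
  "reciprocal_sum (as @ bs) = reciprocal_sum as + reciprocal_sum bs"
  by (induction as) auto

text \<open>The product of the entries is a common denominator. It serves to bound a positive gap
  between two sums from below.\<close>

lemma prod_list_reciprocal_sum_Ints:
  assumes "0 \<notin> set as"
  shows "real (prod_list as) * reciprocal_sum as \<in> \<int>"
  using assms
proof (induction as)
  case (Cons a as)
  have "real (prod_list (a # as)) * reciprocal_sum (a # as)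
      = real (prod_list as) + real a * (real (prod_list as) * reciprocal_sum as)"
    using Cons.prems by (simp add: field_simps)
  also have "\<dots> \<in> \<int>"
    using Cons.prems by (intro Ints_add Ints_of_nat Ints_mult[OF Ints_of_nat Cons.IH]) simp
  finally show ?case .
qed simp

text \<open>A positive integer below 2^(k+1) has 2-part at most 2^k, so 2^k times the product of the
  odd parts clears all denominators: the 2-adic valuation of the sum is at least -k.\<close>

lemma two_adic_reciprocal_sum:
  assumes "\<forall>a\<in>set as. 0 < a \<and> a < 2 ^ Suc k"
  shows "\<exists>m::nat. odd m \<and> real m * 2 ^ k * reciprocal_sum as \<in> \<int>"
  using assms
proof (induction as)
  case Nil
  show ?case by (intro exI[of _ 1]) simp
next
  case (Cons a as)
  then obtain m :: nat where m: "odd m" "real m * 2 ^ k * reciprocal_sum as \<in> \<int>"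
    by auto
  have "a \<noteq> 0" "\<not> is_unit (2::nat)"
    using Cons.prems by auto
  then obtain e b where eb: "a = 2 ^ e * b" "odd b"
    by (metis multiplicity_decompose')
  have "b \<noteq> 0"
    using eb(2) by (metis even_zero)
  then have "2 ^ e \<le> a"
    by (simp add: eb(1))
  also have "a < 2 ^ Suc k"
    using Cons.prems by simp
  finally have "e < Suc k"
    by (simp only: power_strict_increasing_iff)
  then have "(2::real) ^ k = 2 ^ (k - e) * 2 ^ e"
    by (simp flip: power_add)
  with \<open>b \<noteq> 0\<close> have b: "real b * 2 ^ k * (1 / real a) = 2 ^ (k - e)"
    by (simp add: eb(1))
  have "real (m * b) * 2 ^ k * reciprocal_sum (a # as)
      = real m * (real b * 2 ^ k * (1 / real a)) + real b * (real m * 2 ^ k * reciprocal_sum as)"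
    by (simp add: algebra_simps)
  also have "\<dots> = real (m * 2 ^ (k - e)) + real b * (real m * 2 ^ k * reciprocal_sum as)"
    by (simp only: b) simp
  also have "\<dots> \<in> \<int>"
    by (intro Ints_add Ints_of_nat Ints_mult[OF Ints_of_nat m(2)])
  finally show ?case
    using m(1) eb(2) by (intro exI[of _ "m * b"]) simp
qed

section \<open>The series, its partial sums and its tails\<close>

definition theta_denom :: "nat \<Rightarrow> nat" where
  "theta_denom n = 2 ^ fact (Suc n)"

definition theta_tuple :: "nat \<Rightarrow> nat list" where
  "theta_tuple n = map theta_denom [0..<n]"

text \<open>The remainder of \<open>theta\<close> after n terms; with indices from 0, its leading
  term has denominator \<open>theta_denom n\<close>.\<close>

definition theta_tail :: "nat \<Rightarrow> real" where
  "theta_tail n = (\<Sum>k. 1 / real (theta_denom (k + n)))"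

lemma theta_denom_0 [simp]: "theta_denom 0 = 2"
  by (simp add: theta_denom_def)

lemma theta_denom_Suc: "theta_denom (Suc n) = theta_denom n ^ (n + 2)"
proof -
  have "fact (Suc (Suc n)) = fact (Suc n) * (n + 2)"
    by (simp only: fact_Suc[of "Suc n"]) simp
  then show ?thesis
    by (simp only: theta_denom_def power_mult)
qed

lemma theta_denom_ge_2: "2 \<le> theta_denom n"
proof (induction n)
  case (Suc n)
  have "theta_denom n ^ 1 \<le> theta_denom (Suc n)"
    unfolding theta_denom_Suc using Suc by (intro power_increasing) auto
  with Suc show ?case by simp
qed simp

lemma theta_denom_pos [simp]: "0 < theta_denom n"
  using theta_denom_ge_2[of n] by linarith

lemma theta_denom_doubling: "2 * theta_denom n \<le> theta_denom (Suc n)"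
proof -
  have "theta_denom n ^ 2 \<le> theta_denom (Suc n)"
    unfolding theta_denom_Suc using theta_denom_ge_2[of n] by (intro power_increasing) auto
  moreover have "2 * theta_denom n \<le> theta_denom n ^ 2"
    unfolding power2_eq_square using theta_denom_ge_2[of n] by (intro mult_right_mono) auto
  ultimately show ?thesis by linarith
qed

text \<open>Allows a tail to be compared with a geometric series of ratio 1/2.\<close>

lemma theta_denom_geometric: "2 ^ k * theta_denom n \<le> theta_denom (k + n)"
proof (induction k)
  case (Suc k)
  then show ?case using theta_denom_doubling[of "k + n"] by simp
qed simp

lemma summable_theta_denom: "summable (\<lambda>k. 1 / real (theta_denom (k + n)))"
  using summable_ignore_initial_segment[OF summable_theta, of n]
  by (simp add: theta_denom_def del: fact_Suc)

lemma theta_eq_tail: "theta = theta_tail 0"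
  by (simp add: theta_def theta_tail_def theta_denom_def del: fact_Suc)

lemma theta_tail_Suc: "theta_tail n = 1 / real (theta_denom n) + theta_tail (Suc n)"
  unfolding theta_tail_def using suminf_split_head[OF summable_theta_denom[of n]] by simp

lemma theta_tail_pos: "0 < theta_tail n"
  unfolding theta_tail_def by (intro suminf_pos summable_theta_denom) auto

lemma theta_tail_le: "theta_tail n \<le> 2 / real (theta_denom n)"
proof -
  have sums: "(\<lambda>k. (1 / 2) ^ k * (1 / real (theta_denom n))) sums (2 * (1 / real (theta_denom n)))"
    using geometric_sums[of "1 / 2 :: real"] by (intro sums_mult2) simp
  have "theta_tail n \<le> (\<Sum>k. (1 / 2) ^ k * (1 / real (theta_denom n)))"
    unfolding theta_tail_def
  proof (intro suminf_le summable_theta_denom sums_summable[OF sums])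
    fix k
    have "real (2 ^ k * theta_denom n) \<le> real (theta_denom (k + n))"
      using theta_denom_geometric by (rule of_nat_mono)
    then have "1 / real (theta_denom (k + n)) \<le> 1 / real (2 ^ k * theta_denom n)"
      by (intro divide_left_mono) auto
    then show "1 / real (theta_denom (k + n)) \<le> (1 / 2) ^ k * (1 / real (theta_denom n))"
      by (simp add: power_one_over)
  qed
  with sums show ?thesis
    by (simp add: sums_iff)
qed

lemma theta_tuple_0 [simp]: "theta_tuple 0 = []"
  by (simp add: theta_tuple_def)

lemma theta_tuple_Suc: "theta_tuple (Suc n) = theta_tuple n @ [theta_denom n]"
  by (simp add: theta_tuple_def)

lemma theta_split: "theta = reciprocal_sum (theta_tuple n) + theta_tail n"
proof (induction n)
  case (Suc n)
  then show ?case using theta_tail_Suc[of n] by (simp add: theta_tuple_Suc)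
qed (simp add: theta_eq_tail)

text \<open>Over the denominator of the newest term, the older terms have an even numerator and the
  newest one adds 1.\<close>

lemma reciprocal_sum_theta_tuple_odd:
  "\<exists>u::nat. odd u \<and> reciprocal_sum (theta_tuple (Suc n)) = real u / real (theta_denom n)"
proof (induction n)
  case 0
  show ?case by (intro exI[of _ 1]) (simp add: theta_tuple_Suc)
next
  case (Suc n)
  then obtain u :: nat where
    u: "reciprocal_sum (theta_tuple (Suc n)) = real u / real (theta_denom n)"
    by blast
  have "even (theta_denom n)"
    by (simp add: theta_denom_def)
  then have "odd (u * theta_denom n ^ (n + 1) + 1)"
    by simp
  moreover have "reciprocal_sum (theta_tuple (Suc (Suc n)))
      = real (u * theta_denom n ^ (n + 1) + 1) / real (theta_denom (Suc n))"
    by (subst theta_tuple_Suc) (simp add: u theta_denom_Suc field_simps)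
  ultimately show ?case by blast
qed

section \<open>Approximation of \<open>theta\<close> by its partial sums\<close>

lemma liouville_number_theta: "liouville_number theta"
  unfolding liouville_number_def
proof (intro allI impI)
  fix m :: nat
  assume "m \<ge> 1"
  let ?A = "theta_denom m"
  obtain u :: nat where u: "reciprocal_sum (theta_tuple (Suc m)) = real u / real ?A"
    using reciprocal_sum_theta_tuple_odd by blast
  have diff: "theta - real u / real ?A = theta_tail (Suc m)"
    using theta_split[of "Suc m"] u by simp
  \<comment> \<open>With A = \<open>theta_denom m\<close> the error is at most 2/A^(m+2); A^2 >= 4
    absorbs the factor 2 and leaves the inequality strict.\<close>
  have "2 * 2 \<le> real ?A * real ?A"
    using theta_denom_ge_2[of m] by (intro mult_mono) auto
  then have "2 / real (theta_denom (Suc m)) < 1 / real ?A ^ m"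
    by (simp add: theta_denom_Suc field_simps)
  with theta_tail_le[of "Suc m"] have "theta_tail (Suc m) < 1 / real ?A ^ m"
    by linarith
  then show "\<exists>P Q :: int. Q \<ge> 2 \<and> 0 < \<bar>theta - of_int P / of_int Q\<bar> \<and>
      \<bar>theta - of_int P / of_int Q\<bar> < 1 / of_int Q ^ m"
    using theta_tail_pos[of "Suc m"] theta_denom_ge_2[of m]
    by (intro exI[of _ "int u"] exI[of _ "int ?A"]) (simp add: diff)
qed

section \<open>The greedy denominators\<close>

lemma theta_denom_least:
  assumes "2 \<le> x" "1 / real x < theta_tail n"
  shows "theta_denom n \<le> x"
proof (cases n)
  case 0
  with assms show ?thesis by simp
next
  case (Suc k)
  let ?A = "real (theta_denom n)"
  have A: "2 \<le> ?A"
    using theta_denom_ge_2[of n] by linarith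
  show ?thesis
  proof (rule ccontr)
    assume "\<not> theta_denom n \<le> x"
    then have x: "real x \<le> ?A - 1" by linarith
    \<comment> \<open>For n >= 1 the next denominator is at least A^3, so the tail is at most 1/A +
      1/A^2 = (A^2 - 1)/(A^2 (A - 1)), below 1/(A - 1). For n = 0 it is only A^2, but there the
      claim is the assumption 2 <= x.\<close>
    have "?A ^ 3 \<le> ?A ^ (n + 2)"
      using A Suc by (intro power_increasing) auto
    then have "2 / real (theta_denom (Suc n)) \<le> 2 / ?A ^ 3"
      unfolding theta_denom_Suc using A by (intro divide_left_mono) auto
    then have "theta_tail n \<le> 1 / ?A + 2 / ?A ^ 3"
      using theta_tail_Suc[of n] theta_tail_le[of "Suc n"] by linarith
    also have "\<dots> \<le> 1 / ?A + 1 / ?A ^ 2"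
      using A by (simp add: field_simps power2_eq_square power3_eq_cube)
    also have "\<dots> \<le> 1 / (?A - 1)"
      using A by (simp add: field_simps power2_eq_square)
    also have "\<dots> \<le> 1 / real x"
      using A x assms(1) by (intro divide_left_mono) auto
    finally show False using assms(2) by linarith
  qed
qed

lemma theta_denom_less_tail: "1 / real (theta_denom n) < theta_tail n"
  using theta_tail_Suc[of n] theta_tail_pos[of "Suc n"] by linarith

lemma theta_tuple_bound:
  "a \<in> set (theta_tuple n) \<Longrightarrow> a < theta_denom n"
proof (induction n)
  case (Suc n)
  have "theta_denom n < theta_denom (Suc n)"
    using theta_denom_doubling[of n] theta_denom_pos[of n] by linarith
  with Suc show ?case
    by (auto simp: theta_tuple_Suc)
qed simp

lemma theta_tuple_in_denominator_tuples:
  assumes "\<sigma> \<in> {(\<le>), (<)}"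
  shows "theta_tuple n \<in> denominator_tuples \<sigma> n"
proof (induction n)
  case (Suc n)
  have "\<sigma> a (theta_denom n)" if "a \<in> set (theta_tuple n)" for a
    using theta_tuple_bound[OF that] assms by auto
  with Suc theta_denom_ge_2[of n] show ?case
    by (auto simp: denominator_tuples_def theta_tuple_Suc sorted_wrt_append)
qed (simp add: denominator_tuples_def)

text \<open>The order condition never binds: the size condition alone forces x >=
  \<open>theta_denom n\<close>, which already exceeds all earlier entries. Hence both conventions
  give the same tuple.\<close>

lemma greedy_tuple_theta:
  assumes "\<sigma> \<in> {(\<le>), (<)}"
  shows "greedy_tuple \<sigma> theta n = theta_tuple n"
proof (induction n)
  case (Suc n)
  have tail: "theta - reciprocal_sum (theta_tuple n) = theta_tail n"
    using theta_split[of n] by linarith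
  have "(LEAST x. 2 \<le> x \<and> (theta_tuple n \<noteq> [] \<longrightarrow> \<sigma> (last (theta_tuple n)) x) \<and>
      1 / real x < theta - reciprocal_sum (theta_tuple n)) = theta_denom n"
    unfolding tail
  proof (rule Least_equality)
    show "2 \<le> theta_denom n \<and>
        (theta_tuple n \<noteq> [] \<longrightarrow> \<sigma> (last (theta_tuple n)) (theta_denom n)) \<and>
        1 / real (theta_denom n) < theta_tail n"
      using theta_tuple_bound[of "last (theta_tuple n)" n] assms
        theta_denom_ge_2[of n] theta_denom_less_tail[of n] by auto
  qed (auto intro: theta_denom_least)
  with Suc show ?case
    by (simp add: theta_tuple_Suc)
qed simp

section \<open>Optimality and uniqueness\<close>

lemma reciprocal_sum_small_entries:
  assumes len: "length as = Suc n" and as: "\<forall>a\<in>set as. 0 < a \<and> a < theta_denom n"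
    and less: "reciprocal_sum as < theta"
  shows "reciprocal_sum as < reciprocal_sum (theta_tuple (Suc n))"
proof (rule ccontr)
  let ?S = "reciprocal_sum (theta_tuple (Suc n))"
  let ?A = "real (theta_denom n)"
  assume not_less: "\<not> reciprocal_sum as < ?S"
  have A: "2 \<le> ?A"
    using theta_denom_ge_2[of n] by linarith
  obtain u :: nat where u: "odd u" "?S = real u / ?A"
    using reciprocal_sum_theta_tuple_odd by blast
  have "reciprocal_sum as \<noteq> ?S"
  proof
    assume eq: "reciprocal_sum as = ?S"
    obtain k where k: "fact (Suc n) = Suc k"
      by (metis fact_gt_zero gr0_implies_Suc)
    then have A_eq: "theta_denom n = 2 ^ Suc k"
      by (simp only: theta_denom_def)
    obtain m :: nat where m: "odd m" "real m * 2 ^ k * ?S \<in> \<int>"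
      using two_adic_reciprocal_sum[of as k] as unfolding A_eq eq by blast
    \<comment> \<open>As A = 2^(k+1) and S = u/A, the integer on the left would be half of the odd
      number m u.\<close>
    have "real m * 2 ^ k * ?S = real (m * u) / 2"
      by (simp add: u A_eq)
    with m(2) obtain z :: int where "real (m * u) / 2 = of_int z"
      by (auto elim: Ints_cases)
    then have "int (m * u) = 2 * z" by linarith
    then have "even (m * u)" by (metis dvd_triv_left even_of_nat)
    with m(1) u(1) show False by simp
  qed
  with not_less have pos: "0 < reciprocal_sum as - ?S" by linarith
  \<comment> \<open>A common denominator of both sums, so D times their positive difference is an
    integer and hence at least 1.\<close>
  define D where "D = ?A * real (prod_list as)"
  have "0 \<notin> set as" using as by auto
  then have prod_pos: "0 < prod_list as"
    by (metis gr0I prod_list_zero_iff)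
  have "D * (reciprocal_sum as - ?S)
      = ?A * (real (prod_list as) * reciprocal_sum as) - real (prod_list as) * real u"
    using A by (simp add: D_def u field_simps)
  also have "\<dots> \<in> \<int>"
    by (intro Ints_diff Ints_mult[OF Ints_of_nat] Ints_of_nat
        prod_list_reciprocal_sum_Ints \<open>0 \<notin> set as\<close>)
  finally obtain z :: int where z: "D * (reciprocal_sum as - ?S) = of_int z"
    by (elim Ints_cases)
  have D_pos: "0 < D"
    using A prod_pos by (simp add: D_def)
  with pos have "0 < D * (reciprocal_sum as - ?S)"
    by simp
  with z have ge_1: "1 \<le> D * (reciprocal_sum as - ?S)"
    by simp
  have prod_le: "real (prod_list bs) \<le> (?A - 1) ^ length bs" if "\<forall>a\<in>set bs. a < theta_denom n" for bs
    using that
  proof (induction bs)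
    case (Cons b bs)
    then show ?case using A by (auto intro!: mult_mono)
  qed simp
  \<comment> \<open>One factor A - 1 is kept and the other n are weakened to A; the kept factor pays
    for the second term of the tail bound.\<close>
  have "real (prod_list as) \<le> (?A - 1) * (?A - 1) ^ n"
    using prod_le[of as] as len by simp
  also have "\<dots> \<le> (?A - 1) * ?A ^ n"
    using A by (intro mult_left_mono power_mono) auto
  finally have "D \<le> ?A * ((?A - 1) * ?A ^ n)"
    unfolding D_def by (rule mult_left_mono) simp
  then have D_le: "D \<le> (?A - 1) * ?A ^ (n + 1)"
    by (simp add: mult_ac)
  \<comment> \<open>The true exponent is (n + 2)(n + 3); n + 4 suffices and makes the final
    comparison a cubic one in A.\<close>
  have "?A ^ (n + 4) \<le> real (theta_denom (Suc (Suc n)))"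
    unfolding theta_denom_Suc of_nat_power power_mult[symmetric]
    using A by (intro power_increasing) auto
  then have "2 / real (theta_denom (Suc (Suc n))) \<le> 2 / ?A ^ (n + 4)"
    using A by (intro divide_left_mono) auto
  then have tail: "theta_tail (Suc n) \<le> 1 / ?A ^ (n + 2) + 2 / ?A ^ (n + 4)"
    using theta_tail_Suc[of "Suc n"] theta_tail_le[of "Suc (Suc n)"]
    unfolding theta_denom_Suc[of n] by simp
  have "D * (reciprocal_sum as - ?S) < D * theta_tail (Suc n)"
    using D_pos less theta_split[of "Suc n"] by (intro mult_strict_left_mono) auto
  also have "\<dots> \<le> ((?A - 1) * ?A ^ (n + 1)) * (1 / ?A ^ (n + 2) + 2 / ?A ^ (n + 4))"
    using D_le tail D_pos theta_tail_pos[of "Suc n"] A by (intro mult_mono) auto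
  also have "\<dots> = (?A - 1) * (?A ^ 2 + 2) / ?A ^ 3"
    using A by (simp add: field_simps power_add eval_nat_numeral)
  also have "\<dots> \<le> 1"
  proof -
    have "2 * ?A \<le> ?A * ?A" using A by (intro mult_right_mono) auto
    moreover have "(?A - 1) * (?A ^ 2 + 2) = ?A ^ 3 - ?A * ?A + 2 * ?A - 2"
      by (simp add: algebra_simps power2_eq_square power3_eq_cube)
    ultimately have "(?A - 1) * (?A ^ 2 + 2) \<le> ?A ^ 3"
      by linarith
    with A show ?thesis by simp
  qed
  finally show False using ge_1 by linarith
qed

text \<open>The disjunction carries maximality and uniqueness together, as the induction needs both
  for the initial segment \<open>bs\<close>. Strictly increasing tuples are covered too, being
  nondecreasing.\<close>

lemma theta_tuple_optimal:
  assumes "as \<in> denominator_tuples (\<le>) n" "reciprocal_sum as < theta"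
  shows "as = theta_tuple n \<or> reciprocal_sum as < reciprocal_sum (theta_tuple n)"
  using assms
proof (induction n arbitrary: as)
  case 0
  then show ?case by (simp add: denominator_tuples_def)
next
  case (Suc n)
  from Suc.prems(1) obtain bs x where as: "as = bs @ [x]"
    by (cases as rule: rev_cases) (auto simp: denominator_tuples_def)
  with Suc.prems have bs: "bs \<in> denominator_tuples (\<le>) n" and x: "2 \<le> x"
    and le_x: "\<forall>b\<in>set bs. 2 \<le> b \<and> b \<le> x" and len: "length as = Suc n"
    by (auto simp: denominator_tuples_def sorted_wrt_append)
  have less: "reciprocal_sum bs + 1 / real x < theta"
    using Suc.prems(2) by (simp add: as)
  have "0 < 1 / real x"
    using x by simp
  with less have "reciprocal_sum bs < theta" by linarith
  from Suc.IH[OF bs this] show ?case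
  proof
    assume eq: "bs = theta_tuple n"
    then have "1 / real x < theta_tail n"
      using less theta_split[of n] by simp
    with x have "theta_denom n \<le> x"
      by (intro theta_denom_least)
    then have "x = theta_denom n \<or> 1 / real x < 1 / real (theta_denom n)"
      using theta_denom_pos[of n] by (auto simp: le_less intro: divide_strict_left_mono)
    then show ?thesis
      by (auto simp: as eq theta_tuple_Suc)
  next
    assume bs_less: "reciprocal_sum bs < reciprocal_sum (theta_tuple n)"
    show ?thesis
    \<comment> \<open>The last entry x is the largest. If it is below \<open>theta_denom n\<close>,
      so are all entries; otherwise 1/x cannot make up for the deficit of \<open>bs\<close>.\<close>
    proof (cases "x < theta_denom n")
      case True
      with le_x x have "\<forall>a\<in>set as. 0 < a \<and> a < theta_denom n"
        by (auto simp: as)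
      with len Suc.prems(2) show ?thesis
        by (blast intro: reciprocal_sum_small_entries)
    next
      case False
      then have "1 / real x \<le> 1 / real (theta_denom n)"
        using x by (intro divide_left_mono mult_pos_pos) auto
      with bs_less show ?thesis
        by (simp add: as theta_tuple_Suc)
    qed
  qed
qed

theorem mainTheorem2:
  shows "liouville_number theta \<and> theta \<notin> \<rat> \<and>
    (\<forall>\<sigma>\<in>{(\<le>), (<)}. \<forall>n\<ge>1.
      (\<exists>!as. maximizing_tuple \<sigma> n theta as) \<and>
      maximizing_tuple \<sigma> n theta (greedy_tuple \<sigma> theta n))"
proof (intro conjI ballI allI impI)
  show "liouville_number theta"
    by (rule liouville_number_theta)
  then show "theta \<notin> \<rat>"
    by (rule liouville_number_irrational)
  fix \<sigma> :: "nat \<Rightarrow> nat \<Rightarrow> bool" and n :: nat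
  assume \<sigma>: "\<sigma> \<in> {(\<le>), (<)}" and "n \<ge> 1"
  let ?S = "reciprocal_sum (theta_tuple n)"
  have opt: "as = theta_tuple n \<or> reciprocal_sum as < ?S" if "as \<in> under_tuples \<sigma> n theta" for as
  proof (rule theta_tuple_optimal)
    show "as \<in> denominator_tuples (\<le>) n"
      using that \<sigma> by (auto simp: under_tuples_def denominator_tuples_def
        intro: sorted_wrt_mono_rel[of as "(<)" "(\<le>)"])
    show "reciprocal_sum as < theta"
      using that by (simp add: under_tuples_def)
  qed
  have mem: "theta_tuple n \<in> under_tuples \<sigma> n theta"
    using theta_tuple_in_denominator_tuples[OF \<sigma>] theta_split[of n] theta_tail_pos[of n]
    by (simp add: under_tuples_def)
  have "R \<sigma> n theta = ?S"
    unfolding R_def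
  proof (rule Greatest_equality)
    show "?S \<in> reciprocal_sum ` under_tuples \<sigma> n theta"
      using mem by blast
    show "s \<le> ?S" if "s \<in> reciprocal_sum ` under_tuples \<sigma> n theta" for s
      using that opt by fastforce
  qed
  \<comment> \<open>The strict alternative in \<open>opt\<close> excludes any other tuple with the
    same sum.\<close>
  then have iff: "maximizing_tuple \<sigma> n theta as \<longleftrightarrow> as = theta_tuple n" for as
    using mem opt[of as] by (auto simp: maximizing_tuple_def)
  show "\<exists>!as. maximizing_tuple \<sigma> n theta as"
    by (simp add: iff)
  show "maximizing_tuple \<sigma> n theta (greedy_tuple \<sigma> theta n)"
    by (simp add: iff greedy_tuple_theta[OF \<sigma>])
qed

end
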